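(* Let $d\ge 1$, let $\Omega\subset\mathbb{R}^d$ be a Borel set of positive and finite measure, and let $A\subset\mathbb{R}^d$ be a countable set. Let $A$ be a Riesz basis spectrum for $L^2(\Omega)$, i.e. $\{e_a\}_{a\in A}$ is a Riesz basis for $L^2(\Omega)$. Then for any $u\in L^2(\Omega)$, the set $\{u\,e_a\}_{a\in A}$ is a Riesz basis for $L^2(\Omega)$ if and only if $0<\|u\|_0\le\|u\|_\infty<\infty$.
   Context: For $a\in A$, $e_a(x)=e^{-2\pi i\langle x,a\rangle}$ for $x\in\Omega$. For a function $u$, $\|u\|_\infty$ and $\|u\|_0$ denote the supremum and infimum of $|u|$ on $\Omega$, respectively. A family $\{h_a\}_{a\in A}$ in $L^2(\Omega)$ (here $h_a=e_a$ or $h_a=u\,e_a$) is called a Riesz basis for $L^2(\Omega)$ if there exist positive and finite constants $C_1,C_2$ such that for any $f\in L^2(\Omega)$ there is $\{c_a\}_{a\in A}\in\ell^2(A)$ such that $f=\sum_{a\in A}c_ah_a$ and $C_1\sum_{a\in A}|c_a|^2\le\|f\|_{L^2(\Omega)}^2\le C_2\sum_{a\in A}|c_a|^2$. *)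

theory Defs
  imports "HOL-Analysis.Analysis" "HOL-Probability.Essential_Supremum"
begin

text \<open>Elements of \<open>L\<^sup>2(\<Omega>)\<close> are handled through their representatives; all notions below are
  invariant under changes on null sets.\<close>

definition L2_on :: "(real ^ 'd) set \<Rightarrow> (real ^ 'd \<Rightarrow> complex) set" where
  "L2_on \<Omega> = {f \<in> borel_measurable (lebesgue_on \<Omega>).
                integrable (lebesgue_on \<Omega>) (\<lambda>x. (cmod (f x))\<^sup>2)}"

text \<open>For \<open>f \<in> L2_on \<Omega>\<close> only.\<close>

definition L2_norm_on :: "(real ^ 'd) set \<Rightarrow> (real ^ 'd \<Rightarrow> complex) \<Rightarrow> real" where
  "L2_norm_on \<Omega> f = sqrt (\<integral>x. (cmod (f x))\<^sup>2 \<partial>lebesgue_on \<Omega>)"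

text \<open>The index set carries no order, so \<open>f = \<Sum>a\<in>A. g a\<close> in \<open>L\<^sup>2(\<Omega>)\<close> means convergence of the net
  of finite partial sums, as for \<open>has_sum\<close>.\<close>

definition has_L2_sum ::
  "(real ^ 'd) set \<Rightarrow> ('i \<Rightarrow> real ^ 'd \<Rightarrow> complex) \<Rightarrow> 'i set \<Rightarrow> (real ^ 'd \<Rightarrow> complex) \<Rightarrow> bool" where
  "has_L2_sum \<Omega> g A f \<longleftrightarrow>
     ((\<lambda>F. L2_norm_on \<Omega> (\<lambda>x. f x - (\<Sum>a\<in>F. g a x))) \<longlongrightarrow> 0) (finite_subsets_at_top A)"

definition riesz_basis ::
  "(real ^ 'd) set \<Rightarrow> 'i set \<Rightarrow> ('i \<Rightarrow> real ^ 'd \<Rightarrow> complex) \<Rightarrow> bool" where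
  "riesz_basis \<Omega> A h \<longleftrightarrow>
     (\<forall>a\<in>A. h a \<in> L2_on \<Omega>) \<and>
     (\<exists>C1 C2 :: real. 0 < C1 \<and> 0 < C2 \<and>
        (\<forall>f \<in> L2_on \<Omega>. \<exists>c :: 'i \<Rightarrow> complex.
           (\<lambda>a. (cmod (c a))\<^sup>2) summable_on A \<and>
           has_L2_sum \<Omega> (\<lambda>a x. c a * h a x) A f \<and>
           C1 * (\<Sum>\<^sub>\<infinity>a\<in>A. (cmod (c a))\<^sup>2) \<le> (L2_norm_on \<Omega> f)\<^sup>2 \<and>
           (L2_norm_on \<Omega> f)\<^sup>2 \<le> C2 * (\<Sum>\<^sub>\<infinity>a\<in>A. (cmod (c a))\<^sup>2)))"

definition expo :: "real ^ 'd \<Rightarrow> real ^ 'd \<Rightarrow> complex" where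
  "expo a x = exp (- 2 * of_real pi * \<i> * of_real (x \<bullet> a))"

definition riesz_basis_spectrum :: "(real ^ 'd) set \<Rightarrow> (real ^ 'd) set \<Rightarrow> bool" where
  "riesz_basis_spectrum \<Omega> A \<longleftrightarrow> riesz_basis \<Omega> A expo"

text \<open>Supremum and infimum of \<open>\<bar>u\<bar>\<close> over \<open>\<Omega>\<close> for \<open>u \<in> L\<^sup>2(\<Omega>)\<close>, a class of functions
  modulo null sets; hence the essential ones.\<close>

definition sup_abs_on :: "(real ^ 'd) set \<Rightarrow> (real ^ 'd \<Rightarrow> complex) \<Rightarrow> ereal" where
  "sup_abs_on \<Omega> u = esssup (lebesgue_on \<Omega>) (\<lambda>x. ereal (cmod (u x)))"

definition inf_abs_on :: "(real ^ 'd) set \<Rightarrow> (real ^ 'd \<Rightarrow> complex) \<Rightarrow> ereal" where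
  "inf_abs_on \<Omega> u = - esssup (lebesgue_on \<Omega>) (\<lambda>x. - ereal (cmod (u x)))"

end

theory Submission
  imports Defs
begin

text \<open>If \<open>m \<le> \<bar>u\<bar> \<le> B\<close> almost everywhere, expand \<open>f / u\<close> in the exponentials and multiply by \<open>u\<close>.

  Conversely, an expansion \<open>f = \<Sum>a. c a * u * expo a\<close> converges unconditionally, hence its finite
  partial sums stay bounded in \<open>L\<^sup>2(\<Omega>)\<close> when the coefficients are multiplied by numbers of modulus at
  most \<open>1\<close>. The multipliers \<open>expo a t\<close> translate \<open>f / u = \<Sum>a. c a * expo a\<close> by \<open>t\<close>, so
  \<open>\<integral> \<bar>f y / u y\<bar>\<^sup>2 * \<bar>u (y - t)\<bar>\<^sup>2 dy\<close> is bounded by a constant not depending on \<open>t\<close>. If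
  \<open>\<bar>u\<bar>\<close> were not essentially bounded above and below, there would be sets \<open>E n\<close> of positive measure and
  translations \<open>t n\<close> with \<open>\<bar>u (y - t n)\<bar> \<ge> 2 ^ n * \<bar>u y\<bar>\<close> on \<open>E n\<close>, and an \<open>f\<close> with mass
  \<open>(1/2)^n\<close> on each \<open>E n\<close> violates the bound. Neither uniqueness of the coefficients nor
  a Bessel inequality for the exponentials enters, and \<open>riesz_basis\<close> provides neither.\<close>

section \<open>Squared norms with values in \<open>ennreal\<close>\<close>

text \<open>After the triangle inequality the two sides differ by
  \<open>s * (1 - s) * (cmod x - cmod y)\<^sup>2\<close>, which is nonnegative. Integrated, this
  makes the sublevel sets of \<open>nn_sq\<close> convex.\<close>

lemma cmod_convex_square:
  fixes x y :: complex
  assumes "0 \<le> s" "s \<le> (1::real)"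
  shows "(cmod (of_real s * x + of_real (1 - s) * y))\<^sup>2 \<le> s * (cmod x)\<^sup>2 + (1 - s) * (cmod y)\<^sup>2"
proof -
  have "cmod (of_real s * x + of_real (1 - s) * y) \<le> s * cmod x + (1 - s) * cmod y"
    using norm_triangle_ineq[of "of_real s * x" "of_real (1 - s) * y"] assms
    by (simp add: norm_mult del: of_real_diff)
  then have "(cmod (of_real s * x + of_real (1 - s) * y))\<^sup>2 \<le> (s * cmod x + (1 - s) * cmod y)\<^sup>2"
    by (intro power_mono) auto
  also have "\<dots> = s * (cmod x)\<^sup>2 + (1 - s) * (cmod y)\<^sup>2 - s * (1 - s) * (cmod x - cmod y)\<^sup>2"
    by (simp add: power2_eq_square algebra_simps)
  also have "\<dots> \<le> s * (cmod x)\<^sup>2 + (1 - s) * (cmod y)\<^sup>2"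
    using assms by simp
  finally show ?thesis .
qed

lemma cmod_add_square: "(cmod (x + y))\<^sup>2 \<le> 2 * (cmod x)\<^sup>2 + 2 * (cmod y)\<^sup>2"
proof -
  have "(cmod (x + y))\<^sup>2 \<le> (cmod x + cmod y)\<^sup>2"
    by (intro power_mono norm_triangle_ineq) auto
  also have "\<dots> = 2 * (cmod x)\<^sup>2 + 2 * (cmod y)\<^sup>2 - (cmod x - cmod y)\<^sup>2"
    by (simp add: power2_eq_square algebra_simps)
  finally show ?thesis
    using zero_le_power2[of "cmod x - cmod y"] by linarith
qed

text \<open>The squared norm is taken in \<open>ennreal\<close> so that estimates can precede
  integrability: the Bochner integral in \<open>L2_norm_on\<close> is \<open>0\<close> for a
  non-integrable function.\<close>

definition nn_sq :: "'a measure \<Rightarrow> ('a \<Rightarrow> complex) \<Rightarrow> ennreal" where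
  "nn_sq M f = (\<integral>\<^sup>+x. ennreal ((cmod (f x))\<^sup>2) \<partial>M)"

lemma nn_sq_cmult_add:
  assumes [measurable]: "f \<in> borel_measurable M" "g \<in> borel_measurable M"
    and le: "\<And>x. (cmod (h x))\<^sup>2 \<le> p * (cmod (f x))\<^sup>2 + q * (cmod (g x))\<^sup>2"
    and "0 \<le> p" "0 \<le> q"
  shows "nn_sq M h \<le> ennreal p * nn_sq M f + ennreal q * nn_sq M g"
proof -
  have "nn_sq M h \<le> (\<integral>\<^sup>+x. ennreal p * ennreal ((cmod (f x))\<^sup>2) + ennreal q * ennreal ((cmod (g x))\<^sup>2) \<partial>M)"
    unfolding nn_sq_def
  proof (rule nn_integral_mono)
    fix x
    have "ennreal ((cmod (h x))\<^sup>2) \<le> ennreal (p * (cmod (f x))\<^sup>2 + q * (cmod (g x))\<^sup>2)"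
      by (intro ennreal_leI le)
    then show "ennreal ((cmod (h x))\<^sup>2) \<le> ennreal p * ennreal ((cmod (f x))\<^sup>2) + ennreal q * ennreal ((cmod (g x))\<^sup>2)"
      using assms(4,5) by (simp add: ennreal_mult ennreal_plus)
  qed
  also have "\<dots> = ennreal p * nn_sq M f + ennreal q * nn_sq M g"
    unfolding nn_sq_def by (simp add: nn_integral_add nn_integral_cmult)
  finally show ?thesis .
qed

lemma nn_sq_add:
  assumes "f \<in> borel_measurable M" "g \<in> borel_measurable M"
  shows "nn_sq M (\<lambda>x. f x + g x) \<le> 2 * nn_sq M f + 2 * nn_sq M g"
  using nn_sq_cmult_add[OF assms, of "\<lambda>x. f x + g x" 2 2] cmod_add_square by simp

lemma nn_sq_diff:
  assumes "f \<in> borel_measurable M" "g \<in> borel_measurable M"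
  shows "nn_sq M (\<lambda>x. f x - g x) \<le> 2 * nn_sq M f + 2 * nn_sq M g"
  using nn_sq_cmult_add[OF assms, of "\<lambda>x. f x - g x" 2 2] cmod_add_square[of "f _" "- g _"] by simp

lemma nn_sq_convex:
  assumes "f \<in> borel_measurable M" "g \<in> borel_measurable M" "0 \<le> s" "s \<le> 1"
    and "nn_sq M f \<le> K" "nn_sq M g \<le> K"
  shows "nn_sq M (\<lambda>x. of_real s * f x + of_real (1 - s) * g x) \<le> K"
proof -
  have "nn_sq M (\<lambda>x. of_real s * f x + of_real (1 - s) * g x)
      \<le> ennreal s * nn_sq M f + ennreal (1 - s) * nn_sq M g"
    using assms by (intro nn_sq_cmult_add cmod_convex_square) auto
  also have "\<dots> \<le> ennreal s * K + ennreal (1 - s) * K"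
    using assms by (intro add_mono mult_left_mono) auto
  also have "\<dots> = (ennreal s + ennreal (1 - s)) * K" by (simp add: distrib_right)
  also have "ennreal s + ennreal (1 - s) = 1"
    using assms by (simp flip: ennreal_plus)
  finally show ?thesis by simp
qed

section \<open>Bounded multipliers and unconditional convergence\<close>

text \<open>A point of a cube is a convex combination of the vertices, and the vertices correspond
  to plain subsums. Convexity of the sublevel sets of \<open>nn_sq\<close> is applied one coordinate
  at a time.\<close>

lemma nn_sq_positive_multiplier:
  assumes meas: "\<And>a. a \<in> A \<Longrightarrow> g a \<in> borel_measurable M"
    and sub: "\<And>F. finite F \<Longrightarrow> F \<subseteq> A \<Longrightarrow> nn_sq M (\<lambda>x. \<Sum>a\<in>F. g a x) \<le> K"
    and eps: "\<And>a. 0 \<le> \<epsilon> a \<and> \<epsilon> a \<le> (1::real)"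
    and F: "finite F" "F \<subseteq> A"
  shows "nn_sq M (\<lambda>x. \<Sum>a\<in>F. of_real (\<epsilon> a) * g a x) \<le> K"
proof -
  \<comment> \<open>Generalised for the induction: a block \<open>G\<close> disjoint from
    \<open>F\<close> carries the weight \<open>1\<close>, and the removed index \<open>b\<close> may
    either join \<open>G\<close> or be dropped.\<close>
  have "nn_sq M (\<lambda>x. (\<Sum>a\<in>F. of_real (\<epsilon> a) * g a x) + (\<Sum>a\<in>G. g a x)) \<le> K"
    if "finite G" "G \<subseteq> A" "F \<inter> G = {}" for G
    using F that
  proof (induction F arbitrary: G rule: finite_induct)
    case empty
    then show ?case using sub[of G] by simp
  next
    case (insert b F)
    define r where "r = (\<lambda>x. \<Sum>a\<in>F. of_real (\<epsilon> a) * g a x)"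
    have [measurable]: "g a \<in> borel_measurable M" if "a \<in> insert b F \<union> G" for a
      using that insert.prems meas by auto
    have r: "r \<in> borel_measurable M"
      unfolding r_def by (intro borel_measurable_sum borel_measurable_times) auto
    have G: "(\<lambda>x. \<Sum>a\<in>H. g a x) \<in> borel_measurable M" if "H \<subseteq> insert b G" for H
      using that by (intro borel_measurable_sum) auto
    have 1: "nn_sq M (\<lambda>x. r x + (\<Sum>a\<in>insert b G. g a x)) \<le> K"
      unfolding r_def using insert.prems insert.hyps by (intro insert.IH) auto
    have 2: "nn_sq M (\<lambda>x. r x + (\<Sum>a\<in>G. g a x)) \<le> K"
      unfolding r_def using insert.prems by (intro insert.IH) auto
    \<comment> \<open>Averaging the two cases leaves \<open>r\<close> and the sum over
      \<open>G\<close> unchanged and gives \<open>g b\<close> exactly the weight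
      \<open>\<epsilon> b\<close>.\<close>
    have "nn_sq M (\<lambda>x. of_real (\<epsilon> b) * (r x + (\<Sum>a\<in>insert b G. g a x))
        + of_real (1 - \<epsilon> b) * (r x + (\<Sum>a\<in>G. g a x))) \<le> K"
      using eps[of b] by (intro nn_sq_convex 1 2 borel_measurable_add r G) auto
    also have "(\<lambda>x. of_real (\<epsilon> b) * (r x + (\<Sum>a\<in>insert b G. g a x))
        + of_real (1 - \<epsilon> b) * (r x + (\<Sum>a\<in>G. g a x)))
      = (\<lambda>x. (\<Sum>a\<in>insert b F. of_real (\<epsilon> a) * g a x) + (\<Sum>a\<in>G. g a x))"
      using insert.prems insert.hyps by (auto simp: r_def algebra_simps)
    finally show ?case .
  qed
  from this[of "{}"] show ?thesis by simp
qed

text \<open>Each multiplier splits into four with values in the unit interval: the positive and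
  negative parts of its real and imaginary parts. Recombining costs a factor 4 twice, hence
  16.\<close>

lemma nn_sq_multiplier:
  fixes \<epsilon> :: "'i \<Rightarrow> complex"
  assumes meas: "\<And>a. a \<in> A \<Longrightarrow> g a \<in> borel_measurable M"
    and sub: "\<And>F. finite F \<Longrightarrow> F \<subseteq> A \<Longrightarrow> nn_sq M (\<lambda>x. \<Sum>a\<in>F. g a x) \<le> K"
    and eps: "\<And>a. cmod (\<epsilon> a) \<le> 1"
    and F: "finite F" "F \<subseteq> A"
  shows "nn_sq M (\<lambda>x. \<Sum>a\<in>F. \<epsilon> a * g a x) \<le> 16 * K"
proof -
  define S where "S p x = (\<Sum>a\<in>F. of_real (p a) * g a x)" for p :: "'i \<Rightarrow> real" and x
  have S_meas: "S p \<in> borel_measurable M" for p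
    unfolding S_def using F meas by (intro borel_measurable_sum borel_measurable_times) auto
  have S_le: "nn_sq M (S p) \<le> K" if "\<And>a. 0 \<le> p a \<and> p a \<le> 1" for p
    unfolding S_def by (intro nn_sq_positive_multiplier[OF meas sub that F]) auto
  have diff: "nn_sq M (S p) \<le> 4 * K" if p: "\<And>a. \<bar>p a\<bar> \<le> 1" for p
  proof -
    have "S p = (\<lambda>x. S (\<lambda>a. max 0 (p a)) x - S (\<lambda>a. max 0 (- p a)) x)"
      unfolding S_def by (auto simp: sum_subtractf[symmetric] max_def intro!: sum.cong)
    then have "nn_sq M (S p) \<le> 2 * nn_sq M (S (\<lambda>a. max 0 (p a))) + 2 * nn_sq M (S (\<lambda>a. max 0 (- p a)))"
      by (simp only:) (intro nn_sq_diff S_meas)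
    also have "\<dots> \<le> 2 * K + 2 * K"
      using p by (intro add_mono mult_left_mono S_le) (auto simp: abs_le_iff max_def minus_le_iff)
    also have "\<dots> = 4 * K"
      by (subst distrib_right[symmetric]) simp
    finally show ?thesis .
  qed
  define R I where "R = S (\<lambda>a. Re (\<epsilon> a))" and "I = S (\<lambda>a. Im (\<epsilon> a))"
  have "\<epsilon> a * g a x = of_real (Re (\<epsilon> a)) * g a x + \<i> * (of_real (Im (\<epsilon> a)) * g a x)" for a x
    using arg_cong[OF complex_eq[of "\<epsilon> a"], of "\<lambda>z. z * g a x"] by (simp only: distrib_right mult.assoc)
  then have eq: "(\<lambda>x. \<Sum>a\<in>F. \<epsilon> a * g a x) = (\<lambda>x. R x + \<i> * I x)"
    unfolding R_def I_def S_def by (simp add: sum.distrib sum_distrib_left)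
  have le: "nn_sq M (\<lambda>x. R x + \<i> * I x) \<le> 2 * nn_sq M R + 2 * nn_sq M (\<lambda>x. \<i> * I x)"
    unfolding R_def I_def by (intro nn_sq_add borel_measurable_times S_meas) auto
  have iI: "nn_sq M (\<lambda>x. \<i> * I x) = nn_sq M I"
    by (simp add: nn_sq_def norm_mult)
  have "nn_sq M R \<le> 4 * K" "nn_sq M I \<le> 4 * K"
    unfolding R_def I_def
    by (intro diff order_trans[OF abs_Re_le_cmod] order_trans[OF abs_Im_le_cmod] eps)+
  then have "2 * nn_sq M R + 2 * nn_sq M I \<le> 2 * (4 * K) + 2 * (4 * K)"
    by (intro add_mono mult_left_mono) auto
  also have "2 * (4 * K) + 2 * (4 * K) = 16 * K"
    by (subst distrib_right[symmetric]) (simp add: mult.assoc[symmetric])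
  finally show ?thesis
    using le unfolding eq iI by (rule order_trans[rotated])
qed

text \<open>Past some finite \<open>F0\<close> every partial sum is close to \<open>f\<close>. An
  arbitrary finite subsum is such a sum over \<open>F \<union> F0\<close> minus one over
  \<open>F0 - F\<close>, and the latter ranges over the finitely many subsets of
  \<open>F0\<close>.\<close>

lemma nn_sq_subsums_bounded:
  assumes f: "f \<in> borel_measurable M" "nn_sq M f < \<infinity>"
    and g: "\<And>a. a \<in> A \<Longrightarrow> g a \<in> borel_measurable M"
      "\<And>F. finite F \<Longrightarrow> F \<subseteq> A \<Longrightarrow> nn_sq M (\<lambda>x. \<Sum>a\<in>F. g a x) < \<infinity>"
    and conv: "((\<lambda>F. nn_sq M (\<lambda>x. f x - (\<Sum>a\<in>F. g a x))) \<longlongrightarrow> 0) (finite_subsets_at_top A)"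
  obtains K where "K < \<infinity>"
    "\<And>F. finite F \<Longrightarrow> F \<subseteq> A \<Longrightarrow> nn_sq M (\<lambda>x. \<Sum>a\<in>F. g a x) \<le> K"
proof -
  define S where "S F x = (\<Sum>a\<in>F. g a x)" for F x
  have S_meas: "S F \<in> borel_measurable M" if "F \<subseteq> A" for F
    unfolding S_def using that g by (intro borel_measurable_sum) auto
  have "eventually (\<lambda>F. nn_sq M (\<lambda>x. f x - S F x) < 1) (finite_subsets_at_top A)"
    unfolding S_def using conv by (rule order_tendstoD) simp
  then obtain F0 where F0: "finite F0" "F0 \<subseteq> A"
    "\<And>F. finite F \<Longrightarrow> F0 \<subseteq> F \<Longrightarrow> F \<subseteq> A \<Longrightarrow> nn_sq M (\<lambda>x. f x - S F x) < 1"
    unfolding eventually_finite_subsets_at_top by metis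
  define L where "L = (\<Sum>G\<in>Pow F0. nn_sq M (S G))"
  have L: "L < \<infinity>"
    unfolding L_def infinity_ennreal_def
  proof (subst ennreal_sum_less_top)
    show "\<forall>G\<in>Pow F0. nn_sq M (S G) < top"
      unfolding S_def using F0 g(2) finite_subset[OF _ F0(1)] by (auto simp flip: infinity_ennreal_def)
  qed (use F0 in auto)
  \<comment> \<open>Two applications of \<open>nn_sq_diff\<close>, with the remainder beyond
    \<open>F0\<close> bounded by \<open>1\<close>.\<close>
  define K where "K = 2 * (2 * nn_sq M f + 2) + 2 * L"
  have "K < \<infinity>"
    unfolding K_def using f L by (simp add: ennreal_mult_less_top)
  moreover have "nn_sq M (S F) \<le> K" if F: "finite F" "F \<subseteq> A" for F
  proof -
    have split: "S F x = S (F \<union> F0) x - S (F0 - F) x" for x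
    proof -
      have "F \<union> F0 = F \<union> (F0 - F)" by auto
      then have "S (F \<union> F0) x = S F x + S (F0 - F) x"
        unfolding S_def using F F0 by (metis sum.union_disjoint Diff_disjoint finite_Diff)
      then show ?thesis by simp
    qed
    have "nn_sq M (S F) \<le> 2 * nn_sq M (S (F \<union> F0)) + 2 * nn_sq M (S (F0 - F))"
      unfolding split using F F0 by (intro nn_sq_diff S_meas) auto
    moreover have "nn_sq M (S (F \<union> F0)) \<le> 2 * nn_sq M f + 2 * nn_sq M (\<lambda>x. f x - S (F \<union> F0) x)"
      using nn_sq_diff[of f M "\<lambda>x. f x - S (F \<union> F0) x"] F F0
      by (simp add: f S_meas borel_measurable_diff)
    moreover have "nn_sq M (\<lambda>x. f x - S (F \<union> F0) x) \<le> 1"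
      using F F0 by (intro less_imp_le) auto
    moreover have "nn_sq M (S (F0 - F)) \<le> L"
      unfolding L_def by (rule member_le_sum) (use F0 in auto)
    ultimately have "nn_sq M (S F) \<le> 2 * (2 * nn_sq M f + 2 * 1) + 2 * L"
      by (meson add_mono mult_left_mono order_trans order_refl zero_le)
    then show ?thesis by (simp add: K_def)
  qed
  ultimately show ?thesis using that unfolding S_def by blast
qed

section \<open>Calculus in \<open>L2_on\<close>\<close>

lemma nn_sq_lebesgue_on:
  assumes "\<Omega> \<in> sets borel"
  shows "nn_sq (lebesgue_on \<Omega>) f = (\<integral>\<^sup>+x. ennreal ((cmod (f x))\<^sup>2) * indicator \<Omega> x \<partial>lborel)"
  using assms unfolding nn_sq_def by (simp add: nn_integral_restrict_space nn_integral_completion)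

lemma L2_on_iff:
  "f \<in> L2_on \<Omega> \<longleftrightarrow> f \<in> borel_measurable (lebesgue_on \<Omega>) \<and> nn_sq (lebesgue_on \<Omega>) f < \<infinity>"
  unfolding L2_on_def nn_sq_def integrable_iff_bounded by auto

lemma nn_sq_eq_L2_norm_on:
  assumes "f \<in> L2_on \<Omega>"
  shows "nn_sq (lebesgue_on \<Omega>) f = ennreal ((L2_norm_on \<Omega> f)\<^sup>2)"
  using assms unfolding nn_sq_def L2_norm_on_def L2_on_def
  by (simp add: nn_integral_eq_integral)

lemma L2_norm_on_nonneg: "0 \<le> L2_norm_on \<Omega> f"
  by (simp add: L2_norm_on_def)

text \<open>Domination almost everywhere yields membership and the norm estimate together. It serves
  for products with \<open>expo a\<close> and for both multiplication and division by
  \<open>u\<close>.\<close>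

lemma L2_on_bounded_mult:
  assumes "f \<in> L2_on \<Omega>" "g \<in> borel_measurable (lebesgue_on \<Omega>)"
    and "AE x in lebesgue_on \<Omega>. cmod (g x) \<le> B * cmod (f x)"
  shows "g \<in> L2_on \<Omega>"
    and "(L2_norm_on \<Omega> g)\<^sup>2 \<le> B\<^sup>2 * (L2_norm_on \<Omega> f)\<^sup>2"
proof -
  have "AE x in lebesgue_on \<Omega>. ennreal ((cmod (g x))\<^sup>2) \<le> ennreal (B\<^sup>2) * ennreal ((cmod (f x))\<^sup>2)"
    using assms(3)
  proof eventually_elim
    case (elim x)
    then have "(cmod (g x))\<^sup>2 \<le> B\<^sup>2 * (cmod (f x))\<^sup>2"
      by (metis power_mono norm_ge_zero power_mult_distrib)
    then show ?case by (simp add: ennreal_leI flip: ennreal_mult)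
  qed
  then have "nn_sq (lebesgue_on \<Omega>) g \<le> (\<integral>\<^sup>+x. ennreal (B\<^sup>2) * ennreal ((cmod (f x))\<^sup>2) \<partial>lebesgue_on \<Omega>)"
    unfolding nn_sq_def by (rule nn_integral_mono_AE)
  also have "\<dots> = ennreal (B\<^sup>2) * nn_sq (lebesgue_on \<Omega>) f"
    using assms(1) unfolding nn_sq_def L2_on_def by (intro nn_integral_cmult) auto
  finally have le: "nn_sq (lebesgue_on \<Omega>) g \<le> ennreal (B\<^sup>2) * nn_sq (lebesgue_on \<Omega>) f" .
  also have "\<dots> < \<infinity>"
    using assms(1) by (simp add: L2_on_iff ennreal_mult_less_top)
  finally show g: "g \<in> L2_on \<Omega>" using assms(2) by (simp add: L2_on_iff)
  show "(L2_norm_on \<Omega> g)\<^sup>2 \<le> B\<^sup>2 * (L2_norm_on \<Omega> f)\<^sup>2"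
    using le by (simp add: nn_sq_eq_L2_norm_on g assms(1) flip: ennreal_mult)
qed

lemma L2_on_cmult:
  assumes "f \<in> L2_on \<Omega>"
  shows "(\<lambda>x. c * f x) \<in> L2_on \<Omega>"
  using assms by (intro L2_on_bounded_mult(1)[OF assms, where B = "cmod c"])
    (auto simp: L2_on_def norm_mult)

lemma L2_on_add:
  assumes "f \<in> L2_on \<Omega>" "g \<in> L2_on \<Omega>"
  shows "(\<lambda>x. f x + g x) \<in> L2_on \<Omega>"
proof -
  have "nn_sq (lebesgue_on \<Omega>) (\<lambda>x. f x + g x)
      \<le> 2 * nn_sq (lebesgue_on \<Omega>) f + 2 * nn_sq (lebesgue_on \<Omega>) g"
    using assms by (intro nn_sq_add) (auto simp: L2_on_iff)
  also have "\<dots> < \<infinity>"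
    using assms by (auto simp: L2_on_iff ennreal_mult_less_top)
  finally show ?thesis using assms by (auto simp: L2_on_iff)
qed

lemma L2_on_diff:
  assumes "f \<in> L2_on \<Omega>" "g \<in> L2_on \<Omega>"
  shows "(\<lambda>x. f x - g x) \<in> L2_on \<Omega>"
  using L2_on_add[OF assms(1) L2_on_cmult[OF assms(2), of "-1"]] by simp

lemma L2_on_sum:
  assumes "\<And>a. a \<in> F \<Longrightarrow> g a \<in> L2_on \<Omega>"
  shows "(\<lambda>x. \<Sum>a\<in>F. g a x) \<in> L2_on \<Omega>"
  using assms
proof (induction F rule: infinite_finite_induct)
  case (insert a F)
  then show ?case by (simp add: L2_on_add)
qed (auto simp: L2_on_def)

text \<open>Every remainder lies in \<open>L2_on \<Omega>\<close>, so its \<open>nn_sq\<close> is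
  the square of its real norm. This carries the convergence over to \<open>ennreal\<close>, where
  the multiplier estimates live.\<close>

lemma has_L2_sum_imp_nn_sq:
  assumes "has_L2_sum \<Omega> g A f" "f \<in> L2_on \<Omega>" "\<And>a. a \<in> A \<Longrightarrow> g a \<in> L2_on \<Omega>"
  shows "((\<lambda>F. nn_sq (lebesgue_on \<Omega>) (\<lambda>x. f x - (\<Sum>a\<in>F. g a x))) \<longlongrightarrow> 0) (finite_subsets_at_top A)"
proof (rule Lim_transform_eventually)
  have "((\<lambda>F. (L2_norm_on \<Omega> (\<lambda>x. f x - (\<Sum>a\<in>F. g a x)))\<^sup>2) \<longlongrightarrow> 0\<^sup>2) (finite_subsets_at_top A)"
    using assms(1) unfolding has_L2_sum_def by (rule tendsto_power)
  from tendsto_ennrealI[OF this]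
  show "((\<lambda>F. ennreal ((L2_norm_on \<Omega> (\<lambda>x. f x - (\<Sum>a\<in>F. g a x)))\<^sup>2)) \<longlongrightarrow> 0) (finite_subsets_at_top A)"
    by simp
  show "\<forall>\<^sub>F F in finite_subsets_at_top A. ennreal ((L2_norm_on \<Omega> (\<lambda>x. f x - (\<Sum>a\<in>F. g a x)))\<^sup>2)
      = nn_sq (lebesgue_on \<Omega>) (\<lambda>x. f x - (\<Sum>a\<in>F. g a x))"
    by (rule eventually_finite_subsets_at_top_weakI)
      (use assms in \<open>auto intro!: nn_sq_eq_L2_norm_on[symmetric] L2_on_diff L2_on_sum\<close>)
qed

section \<open>Exponentials and translated expansions\<close>

lemma norm_expo [simp]: "cmod (expo a x) = 1"
proof -
  have "- 2 * of_real pi * \<i> * of_real (x \<bullet> a) = \<i> * of_real (- 2 * pi * (x \<bullet> a))"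
    by simp
  then show ?thesis unfolding expo_def by (simp only: norm_exp_i_times)
qed

text \<open>Exponentials are characters, so translating a trigonometric sum by \<open>t\<close>
  multiplies its coefficients by the unimodular numbers \<open>expo a t\<close>, which are
  admissible multipliers.\<close>

lemma expo_add: "expo a (x + t) = expo a t * expo a x"
  unfolding expo_def by (simp add: inner_add_left algebra_simps flip: exp_add)

lemma expo_borel [measurable]: "expo a \<in> borel_measurable borel"
  unfolding expo_def by (intro borel_measurable_continuous_onI continuous_intros)

lemma expo_lebesgue_on: "expo a \<in> borel_measurable (lebesgue_on \<Omega>)"
  by (intro measurable_restrict_space1 measurable_completion) simp

lemma L2_on_mult_expo:
  assumes "u \<in> L2_on \<Omega>"
  shows "(\<lambda>x. u x * expo a x) \<in> L2_on \<Omega>"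
proof (rule L2_on_bounded_mult(1)[OF assms])
  show "(\<lambda>x. u x * expo a x) \<in> borel_measurable (lebesgue_on \<Omega>)"
    using assms by (intro borel_measurable_times expo_lebesgue_on) (simp add: L2_on_def)
  show "AE x in lebesgue_on \<Omega>. cmod (u x * expo a x) \<le> 1 * cmod (u x)"
    by (simp add: norm_mult)
qed

text \<open>Let \<open>h\<close> be a finite sum of \<open>c a * expo a\<close>, so that
  \<open>u * h\<close> approximates \<open>f\<close>. On \<open>E\<close> this makes
  \<open>f\<close> at most about \<open>\<delta>\<close> times \<open>h\<close>, while
  \<open>m\<close> times \<open>h\<close> is dominated there by the translate of
  \<open>u x * h (t + x)\<close>, a partial sum with multipliers \<open>expo a t\<close>. The bound
  \<open>K\<close> depends on the expansion but not on \<open>E\<close>, \<open>t\<close>,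
  \<open>\<delta>\<close> or \<open>m\<close>.\<close>

lemma has_L2_sum_mult_expo_bound:
  fixes \<Omega> :: "(real ^ 'd) set"
  assumes \<Omega>: "\<Omega> \<in> sets borel" and u: "u \<in> L2_on \<Omega>" and f: "f \<in> L2_on \<Omega>"
    and sum: "has_L2_sum \<Omega> (\<lambda>a x. c a * (u x * expo a x)) A f"
  obtains K where "K < \<infinity>"
    "\<And>E t \<delta> m. \<lbrakk>E \<in> sets borel; E \<subseteq> \<Omega>; \<And>y. y \<in> E \<Longrightarrow> y - t \<in> \<Omega>; 0 \<le> \<delta>; 0 \<le> m;
        \<And>y. y \<in> E \<Longrightarrow> cmod (u y) \<le> \<delta>; \<And>y. y \<in> E \<Longrightarrow> m \<le> cmod (u (y - t))\<rbrakk>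
      \<Longrightarrow> ennreal (m\<^sup>2) * nn_sq (lebesgue_on E) f \<le> ennreal (\<delta>\<^sup>2) * K"
proof -
  let ?L = "lebesgue_on \<Omega>"
  define g where "g a x = c a * (u x * expo a x)" for a x
  have g: "g a \<in> L2_on \<Omega>" for a
    unfolding g_def by (intro L2_on_cmult L2_on_mult_expo u)
  have g_sum: "(\<lambda>x. \<Sum>a\<in>F. g a x) \<in> L2_on \<Omega>" for F
    by (intro L2_on_sum g)
  have conv: "((\<lambda>F. nn_sq ?L (\<lambda>x. f x - (\<Sum>a\<in>F. g a x))) \<longlongrightarrow> 0) (finite_subsets_at_top A)"
    using sum unfolding g_def[symmetric] by (intro has_L2_sum_imp_nn_sq f g)
  obtain K where K: "K < \<infinity>" "\<And>F. finite F \<Longrightarrow> F \<subseteq> A \<Longrightarrow> nn_sq ?L (\<lambda>x. \<Sum>a\<in>F. g a x) \<le> K"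
    by (rule nn_sq_subsums_bounded[OF _ _ _ _ conv]) (use f g g_sum in \<open>auto simp: L2_on_iff\<close>)
  show ?thesis
  \<comment> \<open>The factor 16 comes from the multipliers, and another 2 from splitting
    \<open>f\<close> into a partial sum and a remainder.\<close>
  proof (rule that[of "32 * K"])
    show "32 * K < \<infinity>" using K by (simp add: ennreal_mult_less_top)
    fix E t and \<delta> m :: real
    assume E: "E \<in> sets borel" "E \<subseteq> \<Omega>" "\<And>y. y \<in> E \<Longrightarrow> y - t \<in> \<Omega>"
      and "0 \<le> \<delta>" "0 \<le> m"
      and \<delta>: "\<And>y. y \<in> E \<Longrightarrow> cmod (u y) \<le> \<delta>" and m: "\<And>y. y \<in> E \<Longrightarrow> m \<le> cmod (u (y - t))"
    let ?E = "lebesgue_on E"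
    have E_leb: "E \<in> sets lebesgue" using E by auto
    have meas_E: "w \<in> borel_measurable ?E" if "w \<in> L2_on \<Omega>" for w
      using that E measurable_restrict_mono unfolding L2_on_def by blast
    have mono_E: "nn_sq ?E w \<le> nn_sq ?L w" for w
      unfolding nn_sq_lebesgue_on[OF E(1)] nn_sq_lebesgue_on[OF \<Omega>] using E
      by (intro nn_integral_mono mult_left_mono) (auto simp: indicator_def)
    have bound: "ennreal (m\<^sup>2) * nn_sq ?E f
        \<le> ennreal (\<delta>\<^sup>2) * (32 * K) + ennreal (2 * m\<^sup>2) * nn_sq ?L (\<lambda>x. f x - (\<Sum>a\<in>F. g a x))"
      if F: "finite F" "F \<subseteq> A" for F
    proof -
      \<comment> \<open>Unlike \<open>f / u\<close>, the finite sum \<open>h\<close> is defined on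
        the whole space, so it can be translated freely.\<close>
      define h where "h x = (\<Sum>a\<in>F. c a * expo a x)" for x
      have [measurable]: "h \<in> borel_measurable borel" unfolding h_def by measurable
      have gh: "(\<Sum>a\<in>F. g a x) = u x * h x" for x
        unfolding g_def h_def by (simp add: sum_distrib_left mult_ac)
      have "ennreal (m\<^sup>2) * nn_sq ?E h
          = (\<integral>\<^sup>+x. ennreal (m\<^sup>2) * (ennreal ((cmod (h x))\<^sup>2) * indicator E x) \<partial>lborel)"
        unfolding nn_sq_lebesgue_on[OF E(1)] using E(1) by (subst nn_integral_cmult) auto
      \<comment> \<open>Translation invariance of Lebesgue measure moves the domain from
        \<open>E\<close> to its translate by \<open>- t\<close>, which lies in
        \<open>\<Omega>\<close> and on which \<open>m\<close> bounds \<open>cmod (u x)\<close> from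
        below.\<close>
      also have "\<dots> = (\<integral>\<^sup>+x. ennreal (m\<^sup>2) * (ennreal ((cmod (h x))\<^sup>2) * indicator E x)
          \<partial>distr lborel borel ((+) t))"
        by (simp add: lborel_distr_plus)
      also have "\<dots> = (\<integral>\<^sup>+x. ennreal (m\<^sup>2) * (ennreal ((cmod (h (t + x)))\<^sup>2) * indicator E (t + x)) \<partial>lborel)"
        using E(1) by (subst nn_integral_distr) auto
      also have "\<dots> \<le> (\<integral>\<^sup>+x. ennreal ((cmod (\<Sum>a\<in>F. expo a t * g a x))\<^sup>2) * indicator \<Omega> x \<partial>lborel)"
      proof (rule nn_integral_mono)
        fix x
        have *: "(\<Sum>a\<in>F. expo a t * g a x) = u x * h (t + x)"
          unfolding h_def g_def add.commute[of t] by (simp add: sum_distrib_left expo_add mult_ac)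
        show "ennreal (m\<^sup>2) * (ennreal ((cmod (h (t + x)))\<^sup>2) * indicator E (t + x))
          \<le> ennreal ((cmod (\<Sum>a\<in>F. expo a t * g a x))\<^sup>2) * indicator \<Omega> x"
        proof (cases "t + x \<in> E")
          case True
          then have "x \<in> \<Omega>" "m \<le> cmod (u x)" using E(3)[of "t + x"] m[of "t + x"] by auto
          then have "m\<^sup>2 * (cmod (h (t + x)))\<^sup>2 \<le> (cmod (u x * h (t + x)))\<^sup>2"
            using \<open>0 \<le> m\<close> by (simp add: norm_mult power_mult_distrib mult_right_mono power_mono)
          then show ?thesis using True \<open>x \<in> \<Omega>\<close>
            unfolding * by (simp add: ennreal_leI flip: ennreal_mult)
        qed simp
      qed
      also have "\<dots> = nn_sq ?L (\<lambda>x. \<Sum>a\<in>F. expo a t * g a x)"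
        by (simp add: nn_sq_lebesgue_on[OF \<Omega>])
      also have "\<dots> \<le> 16 * K"
        by (rule nn_sq_multiplier[where A = A]) (use g K F in \<open>auto simp: L2_on_iff\<close>)
      finally have h_le: "ennreal (m\<^sup>2) * nn_sq ?E h \<le> 16 * K" .
      have "nn_sq ?E (\<lambda>x. \<Sum>a\<in>F. g a x) \<le> (\<integral>\<^sup>+x. ennreal (\<delta>\<^sup>2) * ennreal ((cmod (h x))\<^sup>2) \<partial>?E)"
        unfolding nn_sq_def gh
      proof (rule nn_integral_mono)
        fix x assume "x \<in> space ?E"
        then have "cmod (u x) \<le> \<delta>" using \<delta> by simp
        then have "(cmod (u x * h x))\<^sup>2 \<le> \<delta>\<^sup>2 * (cmod (h x))\<^sup>2"
          by (simp add: norm_mult power_mult_distrib mult_right_mono power_mono)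
        then show "ennreal ((cmod (u x * h x))\<^sup>2) \<le> ennreal (\<delta>\<^sup>2) * ennreal ((cmod (h x))\<^sup>2)"
          by (simp add: ennreal_leI flip: ennreal_mult)
      qed
      also have "\<dots> = ennreal (\<delta>\<^sup>2) * nn_sq ?E h"
        unfolding nn_sq_def by (intro nn_integral_cmult measurable_restrict_space1
            measurable_completion) measurable
      finally have g_le: "nn_sq ?E (\<lambda>x. \<Sum>a\<in>F. g a x) \<le> ennreal (\<delta>\<^sup>2) * nn_sq ?E h" .
      have "nn_sq ?E f \<le> 2 * nn_sq ?E (\<lambda>x. \<Sum>a\<in>F. g a x) + 2 * nn_sq ?E (\<lambda>x. f x - (\<Sum>a\<in>F. g a x))"
        using nn_sq_add[of "\<lambda>x. \<Sum>a\<in>F. g a x" ?E "\<lambda>x. f x - (\<Sum>a\<in>F. g a x)"]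
          meas_E[OF g_sum] meas_E[OF L2_on_diff[OF f g_sum]] by simp
      also have "\<dots> \<le> 2 * (ennreal (\<delta>\<^sup>2) * nn_sq ?E h) + 2 * nn_sq ?L (\<lambda>x. f x - (\<Sum>a\<in>F. g a x))"
        by (intro add_mono mult_left_mono g_le mono_E) auto
      finally have "ennreal (m\<^sup>2) * nn_sq ?E f
          \<le> ennreal (m\<^sup>2) * (2 * (ennreal (\<delta>\<^sup>2) * nn_sq ?E h) + 2 * nn_sq ?L (\<lambda>x. f x - (\<Sum>a\<in>F. g a x)))"
        by (rule mult_left_mono) simp
      also have "\<dots> = 2 * ennreal (\<delta>\<^sup>2) * (ennreal (m\<^sup>2) * nn_sq ?E h)
          + ennreal (2 * m\<^sup>2) * nn_sq ?L (\<lambda>x. f x - (\<Sum>a\<in>F. g a x))"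
        by (simp add: distrib_left mult_ac ennreal_mult)
      also have "\<dots> \<le> 2 * ennreal (\<delta>\<^sup>2) * (16 * K)
          + ennreal (2 * m\<^sup>2) * nn_sq ?L (\<lambda>x. f x - (\<Sum>a\<in>F. g a x))"
        by (intro add_mono mult_left_mono h_le) auto
      also have "2 * ennreal (\<delta>\<^sup>2) * (16 * K) = ennreal (\<delta>\<^sup>2) * (2 * (16 * K))"
        by (simp only: mult_ac)
      also have "2 * (16 * K) = 32 * K"
        by (simp add: mult.assoc[symmetric])
      finally show ?thesis .
    qed
    \<comment> \<open>The remainder term vanishes along the net of finite sets, while the left side
      of \<open>bound\<close> does not depend on \<open>F\<close>.\<close>
    have "((\<lambda>F. ennreal (\<delta>\<^sup>2) * (32 * K) + ennreal (2 * m\<^sup>2) * nn_sq ?L (\<lambda>x. f x - (\<Sum>a\<in>F. g a x)))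
        \<longlongrightarrow> ennreal (\<delta>\<^sup>2) * (32 * K) + ennreal (2 * m\<^sup>2) * 0) (finite_subsets_at_top A)"
      by (intro tendsto_add tendsto_const ennreal_tendsto_cmult conv) auto
    then have "ennreal (m\<^sup>2) * nn_sq ?E f \<le> ennreal (\<delta>\<^sup>2) * (32 * K) + ennreal (2 * m\<^sup>2) * 0"
      by (rule tendsto_lowerbound) (auto intro!: eventually_finite_subsets_at_top_weakI bound)
    then show "ennreal (m\<^sup>2) * nn_sq ?E f \<le> ennreal (\<delta>\<^sup>2) * (32 * K)" by simp
  qed
qed

section \<open>Sets of positive measure and concentrated functions\<close>

text \<open>By Fubini and translation invariance, the measure of the points of \<open>E\<close> that
  the shift by \<open>s\<close> sends into \<open>G\<close>, integrated over all \<open>s\<close>,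
  is the product of the measures of \<open>E\<close> and \<open>G\<close>. This is positive, so some
  shift works; \<open>t\<close> is its negative.\<close>

lemma exists_translate_inter_positive:
  fixes E G :: "'a::euclidean_space set"
  assumes [measurable]: "E \<in> sets borel" "G \<in> sets borel"
    and pos: "0 < emeasure lborel E" "0 < emeasure lborel G"
  obtains t where "0 < emeasure lborel {y \<in> E. y - t \<in> G}"
proof -
  have "\<exists>s. emeasure lborel {y \<in> E. s + y \<in> G} \<noteq> 0"
  proof (rule ccontr)
    assume "\<not> ?thesis"
    then have zero: "emeasure lborel {y \<in> E. s + y \<in> G} = 0" for s by auto
    have "(\<integral>\<^sup>+y. \<integral>\<^sup>+s. indicator E y * indicator G (s + y) \<partial>lborel \<partial>lborel)
        = (\<integral>\<^sup>+s. \<integral>\<^sup>+y. indicator E y * indicator G (s + y) \<partial>lborel \<partial>(lborel :: 'a measure))"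
      by (rule lborel_pair.Fubini') measurable
    also have "\<dots> = (\<integral>\<^sup>+s. emeasure lborel {y \<in> E. s + y \<in> G} \<partial>lborel)"
    proof (rule nn_integral_cong)
      fix s :: 'a
      have "{y \<in> E. s + y \<in> G} \<in> sets lborel" by measurable
      moreover have "(\<lambda>y. indicator E y * indicator G (s + y) :: ennreal) = indicator {y \<in> E. s + y \<in> G}"
        by (auto simp: fun_eq_iff indicator_def)
      ultimately show "(\<integral>\<^sup>+y. indicator E y * indicator G (s + y) \<partial>lborel) = emeasure lborel {y \<in> E. s + y \<in> G}"
        by (simp only: nn_integral_indicator)
    qed
    also have "\<dots> = 0" by (simp add: zero)
    finally have "(\<integral>\<^sup>+y. \<integral>\<^sup>+s. indicator E y * indicator G (s + y) \<partial>lborel \<partial>lborel) = (0::ennreal)" .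
    moreover have "(\<integral>\<^sup>+s. indicator G (s + y) \<partial>lborel) = emeasure lborel G" for y
    proof -
      have "emeasure lborel G = (\<integral>\<^sup>+s. indicator G s \<partial>distr lborel borel ((+) y))"
        by (simp add: lborel_distr_plus)
      also have "\<dots> = (\<integral>\<^sup>+s. indicator G (y + s) \<partial>lborel)"
        by (subst nn_integral_distr) auto
      finally show ?thesis by (simp add: add.commute)
    qed
    then have "(\<integral>\<^sup>+y. \<integral>\<^sup>+s. indicator E y * indicator G (s + y) \<partial>lborel \<partial>lborel)
        = emeasure lborel E * emeasure lborel G"
      by (simp add: nn_integral_cmult nn_integral_multc)
    ultimately show False using pos by (auto simp: zero_less_iff_neq_zero)
  qed
  then obtain s where "emeasure lborel {y \<in> E. s + y \<in> G} \<noteq> 0" by auto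
  then show ?thesis by (intro that[of "- s"]) (auto simp: add.commute zero_less_iff_neq_zero)
qed

text \<open>A Lebesgue measurable set is a Borel set up to a null set, so positive measure survives
  in the Borel part. Borel sets are what the Fubini and translation arguments on
  \<open>lborel\<close> take as input.\<close>

lemma not_AE_obtain_borel:
  fixes \<Omega> :: "(real ^ 'd) set"
  assumes \<Omega>: "\<Omega> \<in> sets borel" and meas: "Measurable.pred (lebesgue_on \<Omega>) P"
    and "\<not> (AE x in lebesgue_on \<Omega>. \<not> P x)"
  obtains E where "E \<in> sets borel" "E \<subseteq> {x\<in>\<Omega>. P x}" "0 < emeasure lborel E"
proof -
  let ?S = "{x\<in>\<Omega>. P x}"
  have "{x \<in> space (lebesgue_on \<Omega>). P x} \<in> sets (lebesgue_on \<Omega>)"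
    using meas by measurable
  then have S: "?S \<in> sets (lebesgue_on \<Omega>)" by simp
  then have leb: "?S \<in> sets lebesgue"
    using \<Omega> by (auto simp: sets_restrict_space_iff)
  have "emeasure (lebesgue_on \<Omega>) ?S \<noteq> 0"
    using assms(3) AE_iff_measurable[OF S, of "\<lambda>x. \<not> P x"] by auto
  then have pos: "0 < emeasure lebesgue ?S"
    using \<Omega> by (subst (asm) emeasure_restrict_space) (auto simp: zero_less_iff_neq_zero)
  obtain E N N' where E: "?S = E \<union> N" "N \<subseteq> N'" "N' \<in> null_sets lborel" "E \<in> sets lborel"
    by (rule sets_completionE[OF leb])
  have "emeasure lebesgue ?S \<le> emeasure lebesgue E + emeasure lebesgue N'"
    unfolding E(1) using E
    by (intro order_trans[OF emeasure_mono emeasure_subadditive]) (auto simp: null_sets_def)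
  also have "\<dots> = emeasure lborel E" using E by (auto simp: null_sets_def)
  finally have "0 < emeasure lborel E" using pos by (rule less_le_trans[rotated])
  with E show ?thesis by (intro that[of E]) auto
qed

text \<open>The squared modulus of \<open>f\<close> is the sum of the normalised indicators of the
  \<open>E n\<close> with weights \<open>(1/2)^n\<close>. The weights are summable, and overlaps
  between the sets only add mass.\<close>

lemma L2_on_exists_concentrated:
  fixes \<Omega> :: "(real ^ 'd) set"
  assumes \<Omega>: "\<Omega> \<in> sets borel" "emeasure lborel \<Omega> < \<infinity>"
    and E: "\<And>n::nat. E n \<in> sets borel" "\<And>n. E n \<subseteq> \<Omega>" "\<And>n. 0 < emeasure lborel (E n)"
  obtains f where "f \<in> L2_on \<Omega>" "\<And>n. ennreal ((1/2)^n) \<le> nn_sq (lebesgue_on (E n)) f"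
proof -
  note [measurable] = \<Omega>(1) E(1)
  define W where "W n x = ennreal ((1/2)^n) / emeasure lborel (E n) * indicator (E n) x" for n x
  define F where "F x = (\<Sum>n. W n x)" for x
  define f where "f x = complex_of_real (sqrt (enn2real (F x)))" for x
  have [measurable]: "W n \<in> borel_measurable borel" for n unfolding W_def by measurable
  have [measurable]: "F \<in> borel_measurable borel" unfolding F_def by measurable
  have f [measurable]: "f \<in> borel_measurable borel" unfolding f_def by measurable
  have fin: "emeasure lborel (E n) < \<infinity>" for n
    by (rule le_less_trans[OF emeasure_mono[OF E(2)] \<Omega>(2)]) (simp add: \<Omega>(1))
  have W: "(\<integral>\<^sup>+x. W n x \<partial>lborel) = ennreal ((1/2)^n)" for n
  proof -
    have "(\<integral>\<^sup>+x. W n x \<partial>lborel) = ennreal ((1/2)^n) / emeasure lborel (E n) * emeasure lborel (E n)"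
      unfolding W_def by (rule nn_integral_cmult_indicator) (simp add: E(1))
    also have "\<dots> = ennreal ((1/2)^n) * (emeasure lborel (E n) / emeasure lborel (E n))"
      by (rule ennreal_divide_times)
    also have "emeasure lborel (E n) / emeasure lborel (E n) = 1"
      using E(3)[of n] fin[of n] by (intro ennreal_divide_self) auto
    finally show ?thesis by simp
  qed
  have "(\<integral>\<^sup>+x. F x \<partial>lborel) = (\<Sum>n. ennreal ((1/2)^n))"
    unfolding F_def by (subst nn_integral_suminf) (auto simp: W)
  also have "\<dots> \<noteq> top"
    by (rule ennreal_suminf_neq_top) (auto intro: summable_geometric)
  finally have F_fin: "(\<integral>\<^sup>+x. F x \<partial>lborel) < \<infinity>"
    by (simp add: top.not_eq_extremum)
  \<comment> \<open>Where infinitely many sets overlap the series may diverge, and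
    \<open>enn2real\<close> then returns \<open>0\<close>; this happens only on a null set.\<close>
  then have "AE x in lborel. F x \<noteq> \<infinity>"
    by (intro nn_integral_PInf_AE) auto
  then have fF: "AE x in lborel. ennreal ((cmod (f x))\<^sup>2) = F x"
    by eventually_elim (simp add: f_def ennreal_enn2real_if)
  have nn: "nn_sq (lebesgue_on D) f = (\<integral>\<^sup>+x. F x * indicator D x \<partial>lborel)" if "D \<in> sets borel" for D
    unfolding nn_sq_lebesgue_on[OF that] using fF by (intro nn_integral_cong_AE) auto
  have "nn_sq (lebesgue_on \<Omega>) f \<le> (\<integral>\<^sup>+x. F x \<partial>lborel)"
    unfolding nn[OF \<Omega>(1)] by (intro nn_integral_mono) (auto simp: indicator_def)
  then have "f \<in> L2_on \<Omega>"
    using F_fin by (auto simp: L2_on_iff intro!: measurable_restrict_space1 measurable_completion)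
  moreover have "ennreal ((1/2)^n) \<le> nn_sq (lebesgue_on (E n)) f" for n
    unfolding nn[OF E(1)] W[symmetric]
  proof (rule nn_integral_mono)
    fix x
    have "W n x \<le> F x"
      unfolding F_def using sum_le_suminf[of "\<lambda>n. W n x" "{n}"] by simp
    then show "W n x \<le> F x * indicator (E n) x"
      by (cases "x \<in> E n") (auto simp: W_def)
  qed
  ultimately show ?thesis by (rule that)
qed

section \<open>Necessity of the bounds\<close>

text \<open>The negated \<open>AE\<close> statements say that values at most \<open>\<delta>\<close>
  and values at least \<open>m\<close> both occur on sets of positive measure. Stated through the
  ratio of \<open>m\<close> to \<open>\<delta>\<close>, the contradiction covers an unbounded
  \<open>u\<close> as well as one that comes arbitrarily close to zero.\<close>

lemma riesz_basis_mult_expo_ratio_bounded: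
  fixes \<Omega> :: "(real ^ 'd) set"
  assumes \<Omega>: "\<Omega> \<in> sets borel" "emeasure lborel \<Omega> < \<infinity>" and u: "u \<in> L2_on \<Omega>"
    and rb: "riesz_basis \<Omega> A (\<lambda>a x. u x * expo a x)"
    and ratio: "\<And>R::real. \<exists>\<delta> m. 0 < \<delta> \<and> 0 \<le> m \<and> R * \<delta> \<le> m
      \<and> \<not> (AE x in lebesgue_on \<Omega>. \<not> cmod (u x) \<le> \<delta>) \<and> \<not> (AE x in lebesgue_on \<Omega>. \<not> m \<le> cmod (u x))"
  shows False
proof -
  have um [measurable]: "u \<in> borel_measurable (lebesgue_on \<Omega>)" using u by (simp add: L2_on_def)
  have "\<exists>E t \<delta> m. E \<in> sets borel \<and> E \<subseteq> \<Omega> \<and> (\<forall>y\<in>E. y - t \<in> \<Omega>) \<and> 0 < \<delta> \<and> 0 \<le> m \<and> 2 ^ n * \<delta> \<le> m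
      \<and> (\<forall>y\<in>E. cmod (u y) \<le> \<delta>) \<and> (\<forall>y\<in>E. m \<le> cmod (u (y - t))) \<and> 0 < emeasure lborel E" for n :: nat
  proof -
    obtain \<delta> m where *: "0 < \<delta>" "0 \<le> m" "2 ^ n * \<delta> \<le> m"
      "\<not> (AE x in lebesgue_on \<Omega>. \<not> cmod (u x) \<le> \<delta>)" "\<not> (AE x in lebesgue_on \<Omega>. \<not> m \<le> cmod (u x))"
      using ratio[of "2 ^ n"] by blast
    obtain E where E: "E \<in> sets borel" "E \<subseteq> {x\<in>\<Omega>. cmod (u x) \<le> \<delta>}" "0 < emeasure lborel E"
      by (rule not_AE_obtain_borel[OF \<Omega>(1) _ *(4)]) measurable
    obtain G where G: "G \<in> sets borel" "G \<subseteq> {x\<in>\<Omega>. m \<le> cmod (u x)}" "0 < emeasure lborel G"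
      by (rule not_AE_obtain_borel[OF \<Omega>(1) _ *(5)]) measurable
    obtain t where t: "0 < emeasure lborel {y \<in> E. y - t \<in> G}"
      by (rule exists_translate_inter_positive[OF E(1) G(1) E(3) G(3)])
    \<comment> \<open>Restricting \<open>E\<close> to the points that the shift sends into
      \<open>G\<close> secures the small value at \<open>y\<close> and the large value at
      \<open>y - t\<close> simultaneously.\<close>
    have "{y \<in> E. y - t \<in> G} \<in> sets borel" using E(1) G(1) by measurable
    then show ?thesis using * E G t
      by (intro exI[of _ "{y \<in> E. y - t \<in> G}"] exI[of _ t] exI[of _ \<delta>] exI[of _ m]) auto
  qed
  then obtain E t \<delta> m where E: "E n \<in> sets borel" "E n \<subseteq> \<Omega>" "\<forall>y\<in>E n. y - t n \<in> \<Omega>" "0 < \<delta> n" "0 \<le> m n"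
    "2 ^ n * \<delta> n \<le> m n" "\<forall>y\<in>E n. cmod (u y) \<le> \<delta> n" "\<forall>y\<in>E n. m n \<le> cmod (u (y - t n))"
    "0 < emeasure lborel (E n)" for n :: nat
    by metis
  obtain f where f: "f \<in> L2_on \<Omega>" "\<And>n. ennreal ((1/2)^n) \<le> nn_sq (lebesgue_on (E n)) f"
    by (rule L2_on_exists_concentrated[OF \<Omega>, of E]) (use E in blast)+
  obtain c where c: "has_L2_sum \<Omega> (\<lambda>a x. c a * (u x * expo a x)) A f"
    using rb f(1) unfolding riesz_basis_def by blast
  \<comment> \<open>A single \<open>f\<close> serves all \<open>n\<close>, hence so does a single
    \<open>K\<close>.\<close>
  obtain K where K: "K < \<infinity>" "ennreal ((m n)\<^sup>2) * nn_sq (lebesgue_on (E n)) f \<le> ennreal ((\<delta> n)\<^sup>2) * K" for n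
  proof (rule has_L2_sum_mult_expo_bound[OF \<Omega>(1) u f(1) c])
    fix K assume fin: "K < \<infinity>" and K: "\<And>E t \<delta> m. \<lbrakk>E \<in> sets borel; E \<subseteq> \<Omega>; \<And>y. y \<in> E \<Longrightarrow> y - t \<in> \<Omega>; 0 \<le> \<delta>; 0 \<le> m;
        \<And>y. y \<in> E \<Longrightarrow> cmod (u y) \<le> \<delta>; \<And>y. y \<in> E \<Longrightarrow> m \<le> cmod (u (y - t))\<rbrakk>
      \<Longrightarrow> ennreal (m\<^sup>2) * nn_sq (lebesgue_on E) f \<le> ennreal (\<delta>\<^sup>2) * K"
    show thesis
      by (rule that[OF fin], rule K[OF E(1,2) bspec[OF E(3)] less_imp_le[OF E(4)] E(5) bspec[OF E(7)] bspec[OF E(8)]])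
  qed
  obtain k where k: "K = ennreal k" "0 \<le> k" using K(1) by (cases K) auto
  \<comment> \<open>The squared ratio contributes \<open>4 ^ n\<close>, the mass of \<open>f\<close>
    on \<open>E n\<close> only \<open>(1/2)^n\<close>; the surplus \<open>2 ^ n\<close> cannot stay
    bounded.\<close>
  have "2 ^ n \<le> k" for n :: nat
  proof -
    have "ennreal ((m n)\<^sup>2 * (1/2)^n) = ennreal ((m n)\<^sup>2) * ennreal ((1/2)^n)"
      by (simp add: ennreal_mult)
    also have "\<dots> \<le> ennreal ((m n)\<^sup>2) * nn_sq (lebesgue_on (E n)) f"
      by (intro mult_left_mono f) auto
    also have "\<dots> \<le> ennreal ((\<delta> n)\<^sup>2 * k)"
      using K(2)[of n] k by (simp add: ennreal_mult)
    finally have "(m n)\<^sup>2 * (1/2)^n \<le> (\<delta> n)\<^sup>2 * k"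
      using k by (simp add: ennreal_le_iff)
    moreover have "(2 ^ n * \<delta> n)\<^sup>2 * (1/2)^n \<le> (m n)\<^sup>2 * (1/2)^n"
      using E(4,6)[of n] by (intro mult_right_mono power_mono) auto
    moreover have "(2 ^ n * \<delta> n)\<^sup>2 * (1/2)^n = (\<delta> n)\<^sup>2 * 2 ^ n"
      by (simp add: power2_eq_square power_divide)
    ultimately have "(\<delta> n)\<^sup>2 * 2 ^ n \<le> (\<delta> n)\<^sup>2 * k" by linarith
    then show ?thesis using E(4)[of n] by simp
  qed
  moreover obtain n :: nat where "k < 2 ^ n"
    using real_arch_pow[of 2 k] by auto
  ultimately show False by (meson not_le)
qed

text \<open>If \<open>u\<close> vanished almost everywhere, so would every partial sum, and the
  constant \<open>1\<close>, of positive norm, would have no expansion. The ratio argument is silent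
  here, since such a \<open>u\<close> has no large values.\<close>

lemma riesz_basis_mult_expo_not_AE_zero:
  fixes \<Omega> :: "(real ^ 'd) set"
  assumes \<Omega>: "\<Omega> \<in> sets borel" "0 < emeasure lborel \<Omega>" "emeasure lborel \<Omega> < \<infinity>"
    and u: "u \<in> L2_on \<Omega>"
    and rb: "riesz_basis \<Omega> A (\<lambda>a x. u x * expo a x)"
  shows "\<not> (AE x in lebesgue_on \<Omega>. u x = 0)"
proof
  assume zero: "AE x in lebesgue_on \<Omega>. u x = 0"
  have one: "nn_sq (lebesgue_on \<Omega>) (\<lambda>x. 1) = emeasure lborel \<Omega>"
    unfolding nn_sq_lebesgue_on[OF \<Omega>(1)] using \<Omega>(1) by simp
  then have L2: "(\<lambda>x. 1) \<in> L2_on \<Omega>"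
    using \<Omega> by (simp add: L2_on_iff)
  then obtain c where "has_L2_sum \<Omega> (\<lambda>a x. c a * (u x * expo a x)) A (\<lambda>x. 1)"
    using rb unfolding riesz_basis_def by blast
  then have conv: "((\<lambda>F. nn_sq (lebesgue_on \<Omega>) (\<lambda>x. 1 - (\<Sum>a\<in>F. c a * (u x * expo a x)))) \<longlongrightarrow> 0)
      (finite_subsets_at_top A)"
    by (rule has_L2_sum_imp_nn_sq) (intro L2 L2_on_cmult L2_on_mult_expo u)+
  have "nn_sq (lebesgue_on \<Omega>) (\<lambda>x. 1 - (\<Sum>a\<in>F. c a * (u x * expo a x))) = emeasure lborel \<Omega>" for F
    unfolding one[symmetric] unfolding nn_sq_def
    by (rule nn_integral_cong_AE) (use zero in eventually_elim, simp)
  with conv have "((\<lambda>F. emeasure lborel \<Omega>) \<longlongrightarrow> 0) (finite_subsets_at_top A)" by simp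
  then have "emeasure lborel \<Omega> = 0" by (simp add: tendsto_const_iff)
  with \<Omega>(2) show False by simp
qed

section \<open>Sufficiency of the bounds\<close>

text \<open>The coefficients of \<open>f / u\<close> with respect to \<open>h\<close> also expand
  \<open>f\<close>. Division by \<open>u\<close> turns \<open>C1\<close> into
  \<open>m\<^sup>2 * C1\<close>, multiplication by \<open>u\<close> turns \<open>C2\<close> into
  \<open>B\<^sup>2 * C2\<close>.\<close>

lemma riesz_basis_mult_bounded:
  assumes rb: "riesz_basis \<Omega> A h" and u: "u \<in> borel_measurable (lebesgue_on \<Omega>)"
    and h: "\<And>a. a \<in> A \<Longrightarrow> (\<lambda>x. u x * h a x) \<in> L2_on \<Omega>"
    and m: "0 < m" "AE x in lebesgue_on \<Omega>. m \<le> cmod (u x)"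
    and B: "AE x in lebesgue_on \<Omega>. cmod (u x) \<le> B" "0 < B"
  shows "riesz_basis \<Omega> A (\<lambda>a x. u x * h a x)"
proof -
  from rb obtain C1 C2 where h_L2: "\<And>a. a \<in> A \<Longrightarrow> h a \<in> L2_on \<Omega>" and C: "0 < C1" "0 < C2"
    "\<And>f. f \<in> L2_on \<Omega> \<Longrightarrow> \<exists>c. (\<lambda>a. (cmod (c a))\<^sup>2) summable_on A \<and>
           has_L2_sum \<Omega> (\<lambda>a x. c a * h a x) A f \<and>
           C1 * (\<Sum>\<^sub>\<infinity>a\<in>A. (cmod (c a))\<^sup>2) \<le> (L2_norm_on \<Omega> f)\<^sup>2 \<and>
           (L2_norm_on \<Omega> f)\<^sup>2 \<le> C2 * (\<Sum>\<^sub>\<infinity>a\<in>A. (cmod (c a))\<^sup>2)"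
    unfolding riesz_basis_def by blast
  have "\<exists>c. (\<lambda>a. (cmod (c a))\<^sup>2) summable_on A \<and>
           has_L2_sum \<Omega> (\<lambda>a x. c a * (u x * h a x)) A f \<and>
           m\<^sup>2 * C1 * (\<Sum>\<^sub>\<infinity>a\<in>A. (cmod (c a))\<^sup>2) \<le> (L2_norm_on \<Omega> f)\<^sup>2 \<and>
           (L2_norm_on \<Omega> f)\<^sup>2 \<le> B\<^sup>2 * C2 * (\<Sum>\<^sub>\<infinity>a\<in>A. (cmod (c a))\<^sup>2)"
    if f: "f \<in> L2_on \<Omega>" for f
  proof -
    have fm: "f \<in> borel_measurable (lebesgue_on \<Omega>)" using f by (simp add: L2_on_def)
    have q_meas: "(\<lambda>x. f x / u x) \<in> borel_measurable (lebesgue_on \<Omega>)"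
      using fm u by (rule borel_measurable_divide)
    have ae1: "AE x in lebesgue_on \<Omega>. cmod (f x / u x) \<le> inverse m * cmod (f x)"
      using m(2)
    proof eventually_elim
      case (elim x)
      then have "cmod (f x) / cmod (u x) \<le> cmod (f x) / m"
        using m(1) by (intro divide_left_mono mult_pos_pos) auto
      then show ?case by (simp add: norm_divide field_simps)
    qed
    note q = L2_on_bounded_mult[OF f q_meas ae1]
    have ae2: "AE x in lebesgue_on \<Omega>. cmod (f x) \<le> B * cmod (f x / u x)"
      using m(2) B(1)
    proof eventually_elim
      case (elim x)
      then have "cmod (f x) = cmod (u x) * cmod (f x / u x)" using m(1) by (auto simp: norm_divide)
      also have "\<dots> \<le> B * cmod (f x / u x)" using elim by (intro mult_right_mono) auto
      finally show ?case .
    qed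
    note q2 = L2_on_bounded_mult(2)[OF q(1) fm ae2]
    obtain c where c: "(\<lambda>a. (cmod (c a))\<^sup>2) summable_on A"
      "has_L2_sum \<Omega> (\<lambda>a x. c a * h a x) A (\<lambda>x. f x / u x)"
      "C1 * (\<Sum>\<^sub>\<infinity>a\<in>A. (cmod (c a))\<^sup>2) \<le> (L2_norm_on \<Omega> (\<lambda>x. f x / u x))\<^sup>2"
      "(L2_norm_on \<Omega> (\<lambda>x. f x / u x))\<^sup>2 \<le> C2 * (\<Sum>\<^sub>\<infinity>a\<in>A. (cmod (c a))\<^sup>2)"
      using C(3)[OF q(1)] by blast
    have "has_L2_sum \<Omega> (\<lambda>a x. c a * (u x * h a x)) A f"
      unfolding has_L2_sum_def
    \<comment> \<open>Each remainder for \<open>f\<close> is \<open>u\<close> times the remainder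
      for \<open>f / u\<close>, so its norm grows by at most the factor \<open>B\<close>.\<close>
    proof (rule tendsto_sandwich[OF _ _ tendsto_const])
      have "((\<lambda>F. B * L2_norm_on \<Omega> (\<lambda>x. f x / u x - (\<Sum>a\<in>F. c a * h a x))) \<longlongrightarrow> B * 0) (finite_subsets_at_top A)"
        using c(2) unfolding has_L2_sum_def by (intro tendsto_mult tendsto_const)
      then show "((\<lambda>F. B * L2_norm_on \<Omega> (\<lambda>x. f x / u x - (\<Sum>a\<in>F. c a * h a x))) \<longlongrightarrow> 0) (finite_subsets_at_top A)"
        by simp
      show "\<forall>\<^sub>F F in finite_subsets_at_top A. 0 \<le> L2_norm_on \<Omega> (\<lambda>x. f x - (\<Sum>a\<in>F. c a * (u x * h a x)))"
        by (simp add: L2_norm_on_nonneg)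
      show "\<forall>\<^sub>F F in finite_subsets_at_top A. L2_norm_on \<Omega> (\<lambda>x. f x - (\<Sum>a\<in>F. c a * (u x * h a x)))
          \<le> B * L2_norm_on \<Omega> (\<lambda>x. f x / u x - (\<Sum>a\<in>F. c a * h a x))"
      proof (rule eventually_finite_subsets_at_top_weakI)
        fix F assume F: "finite F" "F \<subseteq> A"
        have L2: "(\<lambda>x. f x / u x - (\<Sum>a\<in>F. c a * h a x)) \<in> L2_on \<Omega>"
          using F by (intro L2_on_diff L2_on_sum L2_on_cmult q(1) h_L2) auto
        have "(\<lambda>x. f x - (\<Sum>a\<in>F. c a * (u x * h a x))) \<in> L2_on \<Omega>"
          using F by (intro L2_on_diff L2_on_sum L2_on_cmult f h) auto
        then have meas: "(\<lambda>x. f x - (\<Sum>a\<in>F. c a * (u x * h a x))) \<in> borel_measurable (lebesgue_on \<Omega>)"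
          by (simp add: L2_on_def)
        have "AE x in lebesgue_on \<Omega>. cmod (f x - (\<Sum>a\<in>F. c a * (u x * h a x)))
            \<le> B * cmod (f x / u x - (\<Sum>a\<in>F. c a * h a x))"
          using m(2) B(1)
        proof eventually_elim
          case (elim x)
          then have "f x - (\<Sum>a\<in>F. c a * (u x * h a x)) = u x * (f x / u x - (\<Sum>a\<in>F. c a * h a x))"
            using m(1) by (auto simp: right_diff_distrib sum_distrib_left mult_ac)
          then show ?case using elim by (auto simp: norm_mult intro: mult_right_mono)
        qed
        from L2_on_bounded_mult(2)[OF L2 meas this] show
          "L2_norm_on \<Omega> (\<lambda>x. f x - (\<Sum>a\<in>F. c a * (u x * h a x)))
            \<le> B * L2_norm_on \<Omega> (\<lambda>x. f x / u x - (\<Sum>a\<in>F. c a * h a x))"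
          using B(2) by (simp flip: power_mult_distrib add: L2_norm_on_nonneg power2_le_iff_abs_le)
      qed
    qed
    moreover have "m\<^sup>2 * C1 * (\<Sum>\<^sub>\<infinity>a\<in>A. (cmod (c a))\<^sup>2) \<le> (L2_norm_on \<Omega> f)\<^sup>2"
    proof -
      have "m\<^sup>2 * (C1 * (\<Sum>\<^sub>\<infinity>a\<in>A. (cmod (c a))\<^sup>2)) \<le> m\<^sup>2 * (L2_norm_on \<Omega> (\<lambda>x. f x / u x))\<^sup>2"
        by (intro mult_left_mono c) auto
      also have "\<dots> \<le> m\<^sup>2 * ((inverse m)\<^sup>2 * (L2_norm_on \<Omega> f)\<^sup>2)"
        by (intro mult_left_mono q) auto
      also have "\<dots> = (L2_norm_on \<Omega> f)\<^sup>2" using m(1) by (simp add: power_inverse)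
      finally show ?thesis by (simp add: mult.assoc)
    qed
    moreover have "(L2_norm_on \<Omega> f)\<^sup>2 \<le> B\<^sup>2 * C2 * (\<Sum>\<^sub>\<infinity>a\<in>A. (cmod (c a))\<^sup>2)"
      using order_trans[OF q2 mult_left_mono[OF c(4), of "B\<^sup>2"]] by (simp add: mult.assoc)
    ultimately show ?thesis using c(1) by blast
  qed
  moreover have "0 < m\<^sup>2 * C1" "0 < B\<^sup>2 * C2" using C m B by auto
  ultimately show ?thesis unfolding riesz_basis_def using h by blast
qed

section \<open>Essential supremum and infimum as real bounds\<close>

lemma AE_lebesgue_on_False:
  assumes "\<Omega> \<in> sets borel" "0 < emeasure lborel \<Omega>"
  shows "\<not> (AE x in lebesgue_on \<Omega>. False)"
proof
  assume "AE x in lebesgue_on \<Omega>. False"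
  then have "emeasure (lebesgue_on \<Omega>) (space (lebesgue_on \<Omega>)) = 0"
    by (simp add: AE_iff_measurable[OF sets.top])
  then show False using assms by (simp add: emeasure_restrict_space)
qed

lemma inf_abs_on_pos_iff:
  assumes u: "u \<in> borel_measurable (lebesgue_on \<Omega>)"
  shows "0 < inf_abs_on \<Omega> u \<longleftrightarrow> (\<exists>m>0. AE x in lebesgue_on \<Omega>. m \<le> cmod (u x))"
proof
  have meas: "(\<lambda>x. - ereal (cmod (u x))) \<in> borel_measurable (lebesgue_on \<Omega>)"
    using u by measurable
  {
    assume "0 < inf_abs_on \<Omega> u"
    \<comment> \<open>A real number strictly in between is chosen because the infimum itself may be
      infinite, as it is for a null set \<open>\<Omega>\<close>.\<close>
    then obtain m where m: "0 < ereal m" "ereal m < inf_abs_on \<Omega> u"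
      using ereal_dense2 by blast
    have "AE x in lebesgue_on \<Omega>. - ereal (cmod (u x)) \<le> - inf_abs_on \<Omega> u"
      unfolding inf_abs_on_def using esssup_AE by simp
    then have "AE x in lebesgue_on \<Omega>. m \<le> cmod (u x)"
    proof eventually_elim
      case (elim x)
      then have "inf_abs_on \<Omega> u \<le> ereal (cmod (u x))" by (simp only: ereal_minus_le_minus)
      with m(2) have "ereal m < ereal (cmod (u x))" by (rule less_le_trans)
      then show ?case by simp
    qed
    with m show "\<exists>m>0. AE x in lebesgue_on \<Omega>. m \<le> cmod (u x)" by auto
  next
    assume "\<exists>m>0. AE x in lebesgue_on \<Omega>. m \<le> cmod (u x)"
    then obtain m where m: "0 < m" "AE x in lebesgue_on \<Omega>. m \<le> cmod (u x)" by blast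
    have "esssup (lebesgue_on \<Omega>) (\<lambda>x. - ereal (cmod (u x))) \<le> - ereal m"
      by (rule esssup_I[OF meas]) (use m(2) in eventually_elim, simp)
    then have "ereal m \<le> inf_abs_on \<Omega> u"
      unfolding inf_abs_on_def by (subst ereal_minus_le_minus[symmetric]) simp
    with m(1) show "0 < inf_abs_on \<Omega> u" by (meson ereal_less(2) less_le_trans)
  }
qed

lemma sup_abs_on_finite_iff:
  assumes "u \<in> borel_measurable (lebesgue_on \<Omega>)"
  shows "sup_abs_on \<Omega> u < \<infinity> \<longleftrightarrow> (\<exists>B. AE x in lebesgue_on \<Omega>. cmod (u x) \<le> B)"
proof
  assume "sup_abs_on \<Omega> u < \<infinity>"
  then obtain B where B: "sup_abs_on \<Omega> u < ereal B"
    using ereal_dense2 by blast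
  have "AE x in lebesgue_on \<Omega>. ereal (cmod (u x)) \<le> sup_abs_on \<Omega> u"
    unfolding sup_abs_on_def by (rule esssup_AE)
  then have "AE x in lebesgue_on \<Omega>. cmod (u x) \<le> B"
    by eventually_elim (use B in \<open>metis ereal_less_eq(3) less_imp_le order_trans\<close>)
  then show "\<exists>B. AE x in lebesgue_on \<Omega>. cmod (u x) \<le> B" by blast
next
  assume "\<exists>B. AE x in lebesgue_on \<Omega>. cmod (u x) \<le> B"
  then obtain B where B: "AE x in lebesgue_on \<Omega>. cmod (u x) \<le> B" by blast
  have "sup_abs_on \<Omega> u \<le> ereal B"
    unfolding sup_abs_on_def using assms B by (intro esssup_I) auto
  then show "sup_abs_on \<Omega> u < \<infinity>" by (rule le_less_trans) simp
qed

text \<open>Almost every value of \<open>cmod (u x)\<close> lies between the two, and positive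
  measure guarantees that such a point exists.\<close>

lemma inf_abs_on_le_sup_abs_on:
  assumes "\<Omega> \<in> sets borel" "0 < emeasure lborel \<Omega>"
  shows "inf_abs_on \<Omega> u \<le> sup_abs_on \<Omega> u"
proof (rule ccontr)
  assume gt: "\<not> ?thesis"
  have "AE x in lebesgue_on \<Omega>. - ereal (cmod (u x)) \<le> - inf_abs_on \<Omega> u"
    unfolding inf_abs_on_def using esssup_AE by simp
  moreover have "AE x in lebesgue_on \<Omega>. ereal (cmod (u x)) \<le> sup_abs_on \<Omega> u"
    unfolding sup_abs_on_def by (rule esssup_AE)
  ultimately have "AE x in lebesgue_on \<Omega>. False"
  proof eventually_elim
    case (elim x)
    from elim(1) have "inf_abs_on \<Omega> u \<le> ereal (cmod (u x))" by (simp only: ereal_minus_le_minus)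
    with elim(2) gt show False by (meson order_trans)
  qed
  with AE_lebesgue_on_False[OF assms] show False by blast
qed

section \<open>The equivalence\<close>

theorem corollary1p5:
  fixes \<Omega> A :: "(real ^ 'd) set" and u :: "real ^ 'd \<Rightarrow> complex"
  assumes "\<Omega> \<in> sets borel"
    and "0 < emeasure lborel \<Omega>"
    and "emeasure lborel \<Omega> < \<infinity>"
    and "countable A"
    and "riesz_basis_spectrum \<Omega> A"
    and "u \<in> L2_on \<Omega>"
  shows "riesz_basis \<Omega> A (\<lambda>a x. u x * expo a x) \<longleftrightarrow>
         0 < inf_abs_on \<Omega> u \<and> inf_abs_on \<Omega> u \<le> sup_abs_on \<Omega> u \<and> sup_abs_on \<Omega> u < \<infinity>"
proof -
  let ?L = "lebesgue_on \<Omega>"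
  have um: "u \<in> borel_measurable ?L" using assms(6) by (simp add: L2_on_def)
  have nontriv: "\<not> (AE x in ?L. False)" by (rule AE_lebesgue_on_False[OF assms(1,2)])
  \<comment> \<open>The outer inequalities become real bounds \<open>m\<close> and \<open>B\<close>;
    the middle one always holds on a set of positive measure.\<close>
  have "riesz_basis \<Omega> A (\<lambda>a x. u x * expo a x) \<longleftrightarrow>
      (\<exists>m>0. AE x in ?L. m \<le> cmod (u x)) \<and> (\<exists>B. AE x in ?L. cmod (u x) \<le> B)"
  proof (intro iffI conjI)
    assume rb: "riesz_basis \<Omega> A (\<lambda>a x. u x * expo a x)"
    note bounded = riesz_basis_mult_expo_ratio_bounded[OF assms(1,3,6) rb]
    show "\<exists>m>0. AE x in ?L. m \<le> cmod (u x)"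
    proof (rule ccontr)
      assume unb: "\<not> ?thesis"
      have small: "\<not> (AE x in ?L. \<not> cmod (u x) \<le> \<delta>)" if "0 < \<delta>" for \<delta>
      proof
        assume "AE x in ?L. \<not> cmod (u x) \<le> \<delta>"
        then have "AE x in ?L. \<delta> \<le> cmod (u x)" by eventually_elim simp
        with unb that show False by blast
      qed
      \<comment> \<open>Since \<open>u\<close> is not zero almost everywhere, countably many levels
        suffice to find one that is reached on a set of positive measure. It is the fixed
        \<open>m\<close>, while \<open>\<delta>\<close> can be taken arbitrarily small.\<close>
      have "\<exists>n::nat. \<not> (AE x in ?L. \<not> 1 / Suc n \<le> cmod (u x))"
      proof (rule ccontr)
        assume "\<not> ?thesis"
        then have "AE x in ?L. \<forall>n::nat. \<not> 1 / Suc n \<le> cmod (u x)"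
          by (simp add: AE_all_countable)
        then have "AE x in ?L. u x = 0"
        proof eventually_elim
          case (elim x)
          show ?case
          proof (rule ccontr)
            assume "u x \<noteq> 0"
            then obtain n where "1 / Suc n < cmod (u x)" using nat_approx_posE[of "cmod (u x)"] by auto
            with elim show False by (meson less_imp_le)
          qed
        qed
        with riesz_basis_mult_expo_not_AE_zero[OF assms(1,2,3,6) rb] show False by blast
      qed
      then obtain n :: nat where n: "\<not> (AE x in ?L. \<not> 1 / Suc n \<le> cmod (u x))" by blast
      show False
      proof (rule bounded)
        fix R :: real
        \<comment> \<open>Chosen so that \<open>(\<bar>R\<bar> + 1) * \<delta>\<close> equals
          \<open>m\<close>; the added \<open>1\<close> keeps the divisor positive.\<close>
        define \<delta> where "\<delta> = 1 / Suc n / (\<bar>R\<bar> + 1)"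
        have "0 < \<delta>" by (simp add: \<delta>_def)
        have "R * \<delta> \<le> (\<bar>R\<bar> + 1) * \<delta>" using \<open>0 < \<delta>\<close> by (intro mult_right_mono) auto
        also have "\<dots> = 1 / Suc n"
          unfolding \<delta>_def using nonzero_mult_div_cancel_left[of "\<bar>R\<bar> + 1" "1 / Suc n"] by simp
        finally show "\<exists>\<delta> m. 0 < \<delta> \<and> 0 \<le> m \<and> R * \<delta> \<le> m
            \<and> \<not> (AE x in ?L. \<not> cmod (u x) \<le> \<delta>) \<and> \<not> (AE x in ?L. \<not> m \<le> cmod (u x))"
          using \<open>0 < \<delta>\<close> small n by (intro exI[of _ \<delta>] exI[of _ "1 / Suc n"]) auto
      qed
    qed
    show "\<exists>B. AE x in ?L. cmod (u x) \<le> B"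
    proof (rule ccontr)
      assume unb: "\<not> ?thesis"
      have large: "\<not> (AE x in ?L. \<not> B \<le> cmod (u x))" for B
      proof
        assume "AE x in ?L. \<not> B \<le> cmod (u x)"
        then have "AE x in ?L. cmod (u x) \<le> B" by eventually_elim simp
        with unb show False by blast
      qed
      \<comment> \<open>Here the roles are reversed: as \<open>u\<close> has finite values, some
        level \<open>Suc n\<close> bounds it on a set of positive measure and is the fixed
        \<open>\<delta>\<close>, while \<open>m\<close> can be taken arbitrarily large.\<close>
      have "\<exists>n::nat. \<not> (AE x in ?L. \<not> cmod (u x) \<le> Suc n)"
      proof (rule ccontr)
        assume "\<not> ?thesis"
        then have "AE x in ?L. \<forall>n::nat. \<not> cmod (u x) \<le> Suc n"
          by (simp add: AE_all_countable)
        then have "AE x in ?L. False"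
        proof eventually_elim
          case (elim x)
          obtain n :: nat where "cmod (u x) \<le> n" using real_arch_simple by blast
          then have "cmod (u x) \<le> Suc n" by simp
          with elim show ?case by blast
        qed
        with nontriv show False by blast
      qed
      then obtain n :: nat where n: "\<not> (AE x in ?L. \<not> cmod (u x) \<le> Suc n)" by blast
      show False
      proof (rule bounded)
        fix R :: real
        show "\<exists>\<delta> m. 0 < \<delta> \<and> 0 \<le> m \<and> R * \<delta> \<le> m
            \<and> \<not> (AE x in ?L. \<not> cmod (u x) \<le> \<delta>) \<and> \<not> (AE x in ?L. \<not> m \<le> cmod (u x))"
          using n large by (intro exI[of _ "real (Suc n)"] exI[of _ "\<bar>R\<bar> * real (Suc n)"] conjI)
            (auto intro!: mult_right_mono)
      qed
    qed
  next
    assume "(\<exists>m>0. AE x in ?L. m \<le> cmod (u x)) \<and> (\<exists>B. AE x in ?L. cmod (u x) \<le> B)"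
    then obtain m B where mB: "0 < m" "AE x in ?L. m \<le> cmod (u x)" "AE x in ?L. cmod (u x) \<le> B" by blast
    \<comment> \<open>A point with \<open>m \<le> cmod (u x) \<le> B\<close> exists because
      \<open>\<Omega>\<close> has positive measure.\<close>
    have "0 < B"
    proof (rule ccontr)
      assume "\<not> 0 < B"
      have "AE x in ?L. False" using mB(2,3) by eventually_elim (use mB(1) \<open>\<not> 0 < B\<close> in linarith)
      with nontriv show False by blast
    qed
    show "riesz_basis \<Omega> A (\<lambda>a x. u x * expo a x)"
      using assms(5) unfolding riesz_basis_spectrum_def
      by (rule riesz_basis_mult_bounded[OF _ um L2_on_mult_expo[OF assms(6)] mB \<open>0 < B\<close>])
  qed
  then show ?thesis
    unfolding inf_abs_on_pos_iff[OF um] sup_abs_on_finite_iff[OF um]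
    using inf_abs_on_le_sup_abs_on[OF assms(1,2)] by blast
qed

end
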